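(* Let $n$ be a positive integer and let $b, c \in \mathbb{R}$ with $b,\ c,\ c-b \notin \{0,-1,\dots,-n+1\}$. Let $$X = E\left\{ \tfrac12 \left( |1-c| - |n+b| - |b-c-n| + 1 \right) \right\},$$ $$Y = E\left\{ \tfrac12 \left( -|1-c| + |n+b| - |b-c-n| + 1 \right) \right\},$$ $$Z = E\left\{ \tfrac12 \left( -|1-c| - |n+b| + |b-c-n| + 1 \right) \right\}.$$ Then the numbers of zeros of $F(-n,b;\,c;\,z)$ in the intervals $(1,\infty)$, $(0,1)$ and $(-\infty,0)$ are $N_1$, $N_2$ and $N_3$ respectively, where $$N_1 = \begin{cases} 2\left[(X+1)/2\right] & \text{if } (-1)^n \binom{-b}{n}\binom{b-c}{n} > 0,\\ 2\left[X/2\right]+1 & \text{if } (-1)^n \binom{-b}{n}\binom{b-c}{n} < 0, \end{cases}$$ $$N_2 = \begin{cases} 2\left[(Y+1)/2\right] & \text{if } \binom{-c}{n}\binom{b-c}{n} > 0,\\ 2\left[Y/2\right]+1 & \text{if } \binom{-c}{n}\binom{b-c}{n} < 0, \end{cases}$$ $$N_3 = \begin{cases} 2\left[(Z+1)/2\right] & \text{if } \binom{-c}{n}\binom{-b}{n} > 0,\\ 2\left[Z/2\right]+1 & \text{if } \binom{-c}{n}\binom{-b}{n} < 0. \end{cases}$$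
   Context: For a positive integer $n$ and real $b,c$ with $c\notin\{0,-1,\dots,-n+1\}$, $F(-n,b;\,c;\,z)$ denotes the hypergeometric polynomial $$F(-n,b;\,c;\,z) = 1+\sum_{k=1}^{n} \frac{(-n)_k (b)_k}{(c)_k}\frac{z^k}{k!},\qquad (\alpha)_k = \alpha(\alpha+1)\cdots(\alpha+k-1).$$ $[u]$ denotes the integer part of $u$. $\binom{u}{n} = u(u-1)\cdots(u-n+1)/n!$ for real $u$. Klein's symbol $E$ is defined for real $u$ by: $E(u) = 0$ if $u\le 0$; $E(u) = [u]$ if $u>0$ and $u$ is not an integer; $E(u) = u-1$ if $u = 1,2,3,\dots$. *)

theory Defs
  imports Complex_Main
begin

definition hypergeom_poly :: "nat \<Rightarrow> real \<Rightarrow> real \<Rightarrow> real \<Rightarrow> real" where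
  "hypergeom_poly n b c z =
     1 + (\<Sum>k = 1..n. pochhammer (- real n) k * pochhammer b k / pochhammer c k * (z ^ k / fact k))"

definition klein_E :: "real \<Rightarrow> int" where
  "klein_E u = (if u \<le> 0 then 0 else if u \<in> \<int> then \<lfloor>u\<rfloor> - 1 else \<lfloor>u\<rfloor>)"

text \<open>
  Zeros are counted without multiplicity. In the intervals considered this is the same as counting
  with multiplicity: the polynomial is a nonzero solution of the hypergeometric differential
  equation, whose only finite singular points are 0 and 1, so its zeros elsewhere are simple.
\<close>
definition num_zeros :: "(real \<Rightarrow> real) \<Rightarrow> real set \<Rightarrow> nat" where
  "num_zeros f S = card {z \<in> S. f z = 0}"

end

theory Submission
  imports Defs "HOL-Computational_Algebra.Polynomial" "HOL-Computational_Algebra.Formal_Power_Series"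
begin

text \<open>
  Write \<open>P(n, b, c)\<close> for the polynomial \<open>w \<mapsto> F(-n, b; c; -w)\<close>, whose coefficients are
  \<open>(n choose k) (b)\<^sub>k / (c)\<^sub>k\<close>. The Moebius maps that permute the singular points 0, 1, \<open>\<infinity>\<close>
  of the hypergeometric equation turn the zeros of \<open>F\<close> in each of the three intervals into the
  positive zeros of some \<open>P(n, b', c')\<close>: for \<open>z < 0\<close> nothing is to be done, for \<open>z > 1\<close> expand
  about 1 (\<open>hyp_neg_reflect\<close>), and for \<open>0 < z < 1\<close> first invert \<open>z\<close> (\<open>hyp_neg_reverse\<close>).
  So a single count suffices.

  Let \<open>m\<close> and \<open>i\<close> be the numbers of negative factors of \<open>(b)\<^sub>n\<close> and \<open>(c)\<^sub>n\<close>. The claim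
  (\<open>card_pos_zeros_hyp_neg\<close>) is that \<open>P(n, b, c)\<close> has exactly \<open>m - i\<close> positive zeros if
  \<open>i \<le> m\<close>, and otherwise 0 or 1 of them, according to the parity of \<open>m + i\<close>.

  \<^item> At most \<open>m - i\<close> zeros when \<open>i \<le> m\<close>: the coefficients change sign \<open>m - i\<close> times, and this is
    Descartes' rule of signs.
  \<^item> At least \<open>m - i\<close> zeros: by \<open>hyp_neg_raise\<close> the derivative of
    \<open>w\<^sup>c (1 + w)\<^bsup>b - c\<^esup> P(n, b, c + 1)\<close> is a positive weight times \<open>c P(n + 1, b, c)\<close>. Rolle's theorem
    loses one zero, but gains one at 0 when \<open>c > 0\<close> and one at \<open>\<infinity>\<close> when \<open>b + n < 0\<close>, since the
    product tends to 0 there. This is exactly how \<open>m - i\<close> changes from \<open>n\<close> to \<open>n + 1\<close>.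
  \<^item> At most one zero when \<open>m < i\<close>, which forces \<open>c < b\<close>: by \<open>hyp_neg_raise\<close> and \<open>hyp_neg_lower\<close>,
    the product of \<open>P(n, b, c)\<close>, \<open>(c - 1) P(n + 1, b, c - 1)\<close> and a positive weight has as its
    derivative a positive combination of two squares, so it increases strictly and vanishes at
    most once. As all positive zeros are simple, the signs of the constant and the leading
    coefficient then decide whether there is a zero.

  Finally, comparing Klein's symbol with \<open>m - i\<close> is linear arithmetic: \<open>m\<close> and \<open>i\<close> locate \<open>b\<close> and
  \<open>c\<close> up to unit intervals, which confines the symbol to \<open>m - i - 1\<close> and \<open>m - i\<close> when \<open>i < m\<close>,
  and to 0 otherwise; the rounding in the theorem selects the number of the right parity.
\<close>

section \<open>Counting positive zeros of real functions\<close>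

text \<open>
  Sending each point of \<open>Z\<close> to a point of \<open>W\<close> that lies before the next point of \<open>Z\<close> is injective.
  The form of the hypothesis lets the largest point of \<open>Z\<close> be followed by any later point of \<open>W\<close>,
  which is what a zero at infinity provides.
\<close>
lemma card_le_interlaced:
  fixes Z W :: "real set"
  assumes "finite W" and ex: "\<And>z. z \<in> Z \<Longrightarrow> \<exists>\<xi>\<in>W. z < \<xi> \<and> (\<forall>y\<in>Z. z < y \<longrightarrow> \<xi> < y)"
  shows "card Z \<le> card W"
proof -
  obtain g where g: "\<And>z. z \<in> Z \<Longrightarrow> g z \<in> W \<and> z < g z \<and> (\<forall>y\<in>Z. z < y \<longrightarrow> g z < y)"
    using bchoice[of Z "\<lambda>z \<xi>. \<xi> \<in> W \<and> z < \<xi> \<and> (\<forall>y\<in>Z. z < y \<longrightarrow> \<xi> < y)"] ex by blast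
  have "inj_on g Z"
  proof (rule inj_onI)
    fix x y assume "x \<in> Z" "y \<in> Z" "g x = g y"
    thus "x = y" using g[of x] g[of y] by (metis linorder_neqE_linordered_idom order_less_asym)
  qed
  thus ?thesis using g \<open>finite W\<close> by (meson card_inj_on_le image_subsetI)
qed

lemma rolle_on_half_line:
  fixes f f' :: "real \<Rightarrow> real"
  assumes "a < b" "f a = f b" "continuous_on {a..} f" "\<And>x. x > a \<Longrightarrow> (f has_real_derivative f' x) (at x)"
  shows "\<exists>x. a < x \<and> x < b \<and> f' x = 0"
proof -
  have c: "continuous_on {a..b} f" using assms(3) by (auto intro: continuous_on_subset)
  have d: "(f has_derivative (*) (f' x)) (at x)" if "a < x" "x < b" for x
    using assms(4) that by (simp add: has_field_derivative_def)
  obtain x where x: "a < x" "x < b" "(*) (f' x) = (\<lambda>_. 0)"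
    using Rolle_deriv[OF assms(1,2) c d] by blast
  have "f' x = 0" using fun_cong[OF x(3), of 1] by simp
  thus ?thesis using x by blast
qed

text \<open>
  If \<open>f'\<close> had no zero, \<open>f\<close> would be injective. But \<open>f\<close> leaves the value 0 on \<open>[a, a + 1]\<close> and comes
  close to 0 again later, so it repeats a value, possibly after a further zero.
\<close>
lemma rolle_at_infinity:
  fixes f f' :: "real \<Rightarrow> real"
  assumes cont: "continuous_on {a..} f" and der: "\<And>x. x > a \<Longrightarrow> (f has_real_derivative f' x) (at x)"
    and fa: "f a = 0" and lim: "(f \<longlongrightarrow> 0) at_top"
  shows "\<exists>\<xi>>a. f' \<xi> = 0"
proof (rule ccontr)
  assume no: "\<not> ?thesis"
  have rolle: "f p \<noteq> f q" if pq: "a \<le> p" "p < q" for p q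
  proof
    assume e: "f p = f q"
    have "continuous_on {p..} f" using cont pq(1) by (auto intro: continuous_on_subset)
    then obtain z where "p < z" "f' z = 0" using rolle_on_half_line[OF pq(2) e, of f'] der pq(1) by force
    thus False using no pq by auto
  qed
  define m where "m = \<bar>f (a+1)\<bar>"
  have "m > 0" using rolle[of a "a+1"] fa by (simp add: m_def)
  hence "\<forall>\<^sub>F x in at_top. \<bar>f x\<bar> < m" using tendstoD[OF lim, of m] by simp
  then obtain y where y: "y > a + 1" "\<bar>f y\<bar> < m"
    by (metis (mono_tags, lifting) eventually_at_top_linorder le_max_iff_disj less_add_one max.cobounded1 max.cobounded2 order_less_le_trans)
  have c: "continuous_on {a..a+1} (\<lambda>x. \<bar>f x\<bar>)"
    using cont by (auto intro!: continuous_intros intro: continuous_on_subset)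
  obtain p where p: "a \<le> p" "p \<le> a + 1" "\<bar>f p\<bar> = \<bar>f y\<bar>"
    using IVT'[of "\<lambda>x. \<bar>f x\<bar>" a "\<bar>f y\<bar>" "a+1"] c y fa by (auto simp: m_def)
  show False
  proof (cases "f p = f y")
    case True thus False using rolle[of p y] p y by simp
  next
    case False
    hence "f p = - f y" using p(3) by (auto simp: abs_if split: if_splits)
    have cpy: "continuous_on {p..y} f" using cont p(1) by (auto intro: continuous_on_subset)
    obtain q where "p \<le> q" "q \<le> y" "f q = 0"
    proof (cases "f y \<ge> 0")
      case True
      thus thesis using IVT'[of f p 0 y] cpy p y \<open>f p = - f y\<close> that by auto
    next
      case False
      thus thesis using IVT2'[of f y 0 p] cpy p y \<open>f p = - f y\<close> that by auto
    qed
    moreover have "f p \<noteq> 0" using False \<open>f p = - f y\<close> by auto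
    ultimately have "a < q" using p(1) fa by (cases "q = a") auto
    thus False using rolle[of a q] fa \<open>f q = 0\<close> by simp
  qed
qed

text \<open>
  The point 0 may belong to \<open>Z\<close> even if \<open>f\<close> is not differentiable there; continuity is only asked
  from the points of \<open>Z\<close> on, so that \<open>f\<close> may be singular at 0 if 0 is not counted.
\<close>
lemma card_zeros_le_card_deriv_zeros:
  fixes f f' :: "real \<Rightarrow> real"
  assumes fin: "finite Z" "finite W" and Z: "\<And>z. z \<in> Z \<Longrightarrow> z \<ge> 0 \<and> f z = 0 \<and> continuous_on {z..} f"
    and der: "\<And>x. x > 0 \<Longrightarrow> (f has_real_derivative f' x) (at x)"
    and W: "\<And>x. x > 0 \<Longrightarrow> f' x = 0 \<Longrightarrow> x \<in> W"
  shows "card Z \<le> card W + 1" and "(f \<longlongrightarrow> 0) at_top \<Longrightarrow> card Z \<le> card W"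
proof -
  have gap: "\<exists>\<xi>\<in>W. z < \<xi> \<and> (\<forall>y\<in>Z. z < y \<longrightarrow> \<xi> < y)" if z: "z \<in> Z" "z \<noteq> Max Z" for z
  proof -
    define A where "A = {y \<in> Z. z < y}"
    have "z < Max Z \<and> Max Z \<in> Z"
      using z Max_ge[OF fin(1) z(1)] Max_in[OF fin(1)] by (metis empty_iff order_less_le)
    hence A: "finite A" "A \<noteq> {}" using fin(1) unfolding A_def by auto
    define y where "y = Min A"
    have y: "y \<in> Z" "z < y" using Min_in[OF A] by (auto simp: y_def A_def)
    obtain x where x: "z < x" "x < y" "f' x = 0"
      using rolle_on_half_line[of z y f f'] y Z[OF z(1)] Z[OF y(1)] der by force
    have "x < v" if "v \<in> Z" "z < v" for v
      using Min_le[OF A(1), of v] that x by (auto simp: y_def A_def)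
    thus ?thesis using W[of x] x Z[OF z(1)] by force
  qed
  have "card (Z - {Max Z}) \<le> card W"
    by (rule card_le_interlaced[OF fin(2)]) (use gap in blast)
  thus "card Z \<le> card W + 1" using fin(1) by (cases "Max Z \<in> Z") (auto simp: card_Diff_singleton)
  show "card Z \<le> card W" if lim: "(f \<longlongrightarrow> 0) at_top"
  proof (rule card_le_interlaced)
    fix z assume z: "z \<in> Z"
    show "\<exists>\<xi>\<in>W. z < \<xi> \<and> (\<forall>y\<in>Z. z < y \<longrightarrow> \<xi> < y)"
    proof (cases "z = Max Z")
      case True
      obtain x where "x > z" "f' x = 0" using rolle_at_infinity[of z f f'] Z[OF z] der lim by force
      moreover have "\<not> z < y" if "y \<in> Z" for y using True that fin by (simp add: leD)
      ultimately show ?thesis using W[of x] Z[OF z] by force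
    qed (use gap z in auto)
  qed (use fin in auto)
qed

abbreviation pos_zeros :: "real poly \<Rightarrow> real set" where
  "pos_zeros p \<equiv> {x. 0 < x \<and> poly p x = 0}"

lemma poly_pos_if_coeffs_nonneg:
  fixes p :: "real poly"
  assumes "\<And>k. coeff p k \<ge> 0" "coeff p 0 > 0" "x > 0"
  shows "poly p x > 0"
proof -
  have "poly p x = (\<Sum>k\<le>degree p. coeff p k * x ^ k)" by (simp add: poly_altdef)
  also have "\<dots> > 0" using assms by (intro sum_pos2[of _ 0]) auto
  finally show ?thesis .
qed

text \<open>
  Descartes' rule of signs, with the sign changes located by real numbers \<open>s\<close> such that multiplying
  the \<open>k\<close>-th coefficient by all the \<open>s - k\<close> removes every change. One factor \<open>s - k\<close> is the effect of
  \<open>p \<mapsto> s p - x p'\<close>, which up to the factor \<open>- x\<^bsup>-s-1\<^esup>\<close> is the derivative of \<open>x\<^bsup>-s\<^esup> p\<close>. So by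
  Rolle each \<open>s\<close> costs at most one positive zero.
\<close>
lemma descartes_sign_bound:
  fixes p :: "real poly"
  assumes "\<And>k. coeff p k * (\<Prod>s\<leftarrow>ss. s - real k) \<ge> 0" and "coeff p 0 * prod_list ss > 0"
  shows "card {x. 0 < x \<and> poly p x = 0} \<le> length ss"
  using assms
proof (induction ss arbitrary: p)
  case Nil
  hence "{x. 0 < x \<and> poly p x = 0} = {}" using poly_pos_if_coeffs_nonneg[of p] by force
  thus ?case by (metis card.empty le0)
next
  case (Cons s ss)
  define q where "q = smult s p - [:0,1:] * pderiv p"
  have cq: "coeff q k = (s - real k) * coeff p k" for k
    by (cases k) (auto simp: q_def coeff_pderiv algebra_simps)
  have IH: "card {x. 0 < x \<and> poly q x = 0} \<le> length ss"
    using Cons.prems by (intro Cons.IH) (auto simp: cq mult_ac)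
  have p: "p \<noteq> 0" and q: "q \<noteq> 0" using Cons.prems(2) cq[of 0] by auto
  have "card {x. 0 < x \<and> poly p x = 0} \<le> card {x. 0 < x \<and> poly q x = 0} + 1"
  proof (rule card_zeros_le_card_deriv_zeros(1))
    show "finite {x. 0 < x \<and> poly p x = 0}" "finite {x. 0 < x \<and> poly q x = 0}"
      using poly_roots_finite[OF p] poly_roots_finite[OF q] by auto
    show "((\<lambda>x. x powr (-s) * poly p x) has_real_derivative (- (x powr (-s - 1) * poly q x))) (at x)" if "x > 0" for x
    proof -
      have "((\<lambda>x. x powr (-s) * poly p x) has_real_derivative
        (- s * x powr (-s - 1) * poly p x + x powr (-s) * poly (pderiv p) x)) (at x)"
        using that by (auto intro!: derivative_eq_intros has_real_derivative_powr)
      moreover have "x powr (-s) = x powr (-s - 1) * x" using powr_add[of x "-s-1" 1] that by simp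
      ultimately show ?thesis by (simp add: q_def algebra_simps)
    qed
    show "0 \<le> z \<and> z powr (-s) * poly p z = 0 \<and> continuous_on {z..} (\<lambda>x. x powr (-s) * poly p x)"
      if "z \<in> {x. 0 < x \<and> poly p x = 0}" for z
      using that by (auto intro!: continuous_intros)
  qed auto
  with IH show ?case by simp
qed

lemma pos_root_if_lead_neg:
  fixes p :: "real poly"
  assumes "poly p a > 0" "lead_coeff p < 0"
  shows "\<exists>x>a. poly p x = 0"
proof -
  obtain M where M: "\<And>x. x \<ge> M \<Longrightarrow> poly (- p) x \<ge> lead_coeff (- p)"
    using poly_pinfty_gt_lc[of "- p"] assms by auto
  define y where "y = max M (a + 1)"
  have "poly p y < 0" "a < y" using M[of y] assms by (auto simp: y_def)
  thus ?thesis using poly_IVT_neg[of a y p] assms by auto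
qed

section \<open>The hypergeometric polynomial and its contiguous relations\<close>

text \<open>
  The polynomial \<open>F(-n, b; c; -w)\<close>: with the argument reversed, the signs of \<open>(-n)\<^sub>k\<close> disappear from
  the coefficients.
\<close>
definition hyp_neg :: "nat \<Rightarrow> real \<Rightarrow> real \<Rightarrow> real poly" where
  "hyp_neg n b c = (\<Sum>k\<le>n. monom (real (n choose k) * pochhammer b k / pochhammer c k) k)"

lemma coeff_hyp_neg: "coeff (hyp_neg n b c) k = real (n choose k) * pochhammer b k / pochhammer c k"
proof -
  have "coeff (hyp_neg n b c) k
      = (\<Sum>j\<le>n. if j = k then real (n choose j) * pochhammer b j / pochhammer c j else 0)"
    by (simp add: hyp_neg_def coeff_sum)
  also have "\<dots> = real (n choose k) * pochhammer b k / pochhammer c k"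
    by (subst sum.delta) (auto simp: binomial_eq_0)
  finally show ?thesis .
qed

lemma poly_hyp_neg: "poly (hyp_neg n b c) x = (\<Sum>k\<le>n. real (n choose k) * pochhammer b k / pochhammer c k * x ^ k)"
  by (simp add: hyp_neg_def poly_sum poly_monom)

lemma coeff_hyp_neg_0 [simp]: "coeff (hyp_neg n b c) 0 = 1"
  by (simp add: coeff_hyp_neg)

lemma hyp_neg_nonzero [simp]: "hyp_neg n b c \<noteq> 0"
  using coeff_hyp_neg_0[of n b c] by (metis coeff_0 zero_neq_one)

lemma hyp_neg_0 [simp]: "hyp_neg 0 b c = 1"
  by (simp add: hyp_neg_def)

lemma pochhammer_nonzero_mono: "pochhammer c n \<noteq> 0 \<Longrightarrow> k \<le> n \<Longrightarrow> pochhammer c k \<noteq> (0::real)"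
  by (auto simp: pochhammer_eq_0_iff)

lemma hypergeom_poly_eq_hyp_neg: "hypergeom_poly n b c z = poly (hyp_neg n b c) (- z)"
proof -
  have *: "pochhammer (- real n) k * pochhammer b k / pochhammer c k * (z ^ k / fact k)
     = real (n choose k) * pochhammer b k / pochhammer c k * (- z) ^ k" for k
    by (simp add: binomial_gbinomial gbinomial_pochhammer power_minus[of z] field_simps)
  have "poly (hyp_neg n b c) (- z) = 1 + (\<Sum>k=1..n. real (n choose k) * pochhammer b k / pochhammer c k * (- z) ^ k)"
    unfolding poly_hyp_neg atMost_atLeast0 by (subst sum.atLeast_Suc_atMost) auto
  thus ?thesis by (simp only: hypergeom_poly_def *)
qed

text \<open>
  In the \<open>k\<close>-th coefficient both contributions are the same number times \<open>n choose k\<close> and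
  \<open>n choose (k - 1)\<close>, so this is Pascal's rule. The left-hand side is the derivative of
  \<open>w\<^sup>c (1 + w)\<^bsup>b - c\<^esup> F(-n, b; c + 1; -w)\<close>, divided by \<open>w\<^bsup>c - 1\<^esup> (1 + w)\<^bsup>b - c - 1\<^esup>\<close>.
\<close>
lemma hyp_neg_raise:
  assumes "pochhammer c (Suc n) \<noteq> 0"
  shows "[:0,1,1:] * pderiv (hyp_neg n b (c+1)) + [:c,b:] * hyp_neg n b (c+1) = smult c (hyp_neg (Suc n) b c)"
proof (rule poly_eqI)
  fix k
  let ?p = "hyp_neg n b (c+1)"
  have e: "[:0,1,1:] * pderiv ?p + [:c,b:] * ?p
     = pCons 0 (pderiv ?p + pCons 0 (pderiv ?p)) + (smult c ?p + pCons 0 (smult b ?p))"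
    by simp
  show "coeff ([:0,1,1:] * pderiv ?p + [:c,b:] * ?p) k = coeff (smult c (hyp_neg (Suc n) b c)) k"
  proof (cases k)
    case 0 thus ?thesis by (simp add: coeff_mult_0)
  next
    case (Suc l)
    have c0: "c \<noteq> 0" using assms by (auto simp: pochhammer_rec)
    show ?thesis
    proof (cases "l \<le> n")
      case False thus ?thesis unfolding e Suc
        by (cases l) (auto simp: coeff_pderiv coeff_hyp_neg binomial_eq_0 coeff_pCons)
    next
      case True
      define T where "T = pochhammer b (Suc l) / pochhammer (c+1) l"
      have nz: "pochhammer (c+1) l \<noteq> 0" using assms pochhammer_nonzero_mono[OF _ True] by (auto simp: pochhammer_rec)
      have A: "coeff ?p l * (b + real l) = real (n choose l) * T"
        by (simp add: coeff_hyp_neg T_def pochhammer_Suc)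
      have B: "coeff ?p (Suc l) * (c + 1 + real l) = real (n choose Suc l) * T"
      proof (cases "Suc l \<le> n")
        case True
        hence "pochhammer (c+1) (Suc l) \<noteq> 0" using assms pochhammer_nonzero_mono[OF _ True, of "c+1"] by (auto simp: pochhammer_rec)
        hence "c + 1 + real l \<noteq> 0" by (simp add: pochhammer_Suc)
        thus ?thesis unfolding coeff_hyp_neg T_def pochhammer_Suc[of "c+1"] by simp
      qed (simp add: coeff_hyp_neg binomial_eq_0)
      have "coeff ([:0,1,1:] * pderiv ?p + [:c,b:] * ?p) k
         = coeff ?p (Suc l) * (c + 1 + real l) + coeff ?p l * (b + real l)"
        unfolding e Suc by (cases l) (auto simp: coeff_pderiv algebra_simps)
      also have "\<dots> = real (Suc n choose Suc l) * T" unfolding A B by (simp add: algebra_simps)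
      also have "\<dots> = coeff (smult c (hyp_neg (Suc n) b c)) k"
        using c0 by (simp add: Suc coeff_hyp_neg T_def pochhammer_rec[of c])
      finally show ?thesis .
    qed
  qed
qed

lemma poly_hyp_neg_raise:
  assumes "pochhammer c (Suc n) \<noteq> 0"
  shows "w * (1 + w) * poly (pderiv (hyp_neg n b (c+1))) w
    = c * poly (hyp_neg (Suc n) b c) w - (c + b * w) * poly (hyp_neg n b (c+1)) w"
  using arg_cong[OF hyp_neg_raise[OF assms, of b], of "\<lambda>p. poly p w"] by (simp add: algebra_simps)

text \<open>
  The left-hand side is the derivative of \<open>(1 + w)\<^bsup>-(n + 1)\<^esup> F(-(n + 1), b; c; -w)\<close>, divided by
  \<open>(1 + w)\<^bsup>-(n + 2)\<^esup>\<close>. Together with \<open>hyp_neg_raise\<close> this splits the second-order hypergeometric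
  equation into two first-order relations.
\<close>
lemma hyp_neg_lower:
  assumes "pochhammer c (Suc n) \<noteq> 0"
  shows "[:1,1:] * pderiv (hyp_neg (Suc n) b c) - smult (real (Suc n)) (hyp_neg (Suc n) b c)
       = smult (real (Suc n) * (b - c) / c) (hyp_neg n b (c+1))"
proof (rule poly_eqI)
  fix k
  let ?p = "hyp_neg (Suc n) b c"
  have c0: "c \<noteq> 0" using assms by (auto simp: pochhammer_rec)
  have "coeff ([:1,1:] * pderiv ?p - smult (real (Suc n)) ?p) k
     = real (Suc k) * coeff ?p (Suc k) + (real k - real (Suc n)) * coeff ?p k"
    by (cases k) (auto simp: coeff_pderiv algebra_simps)
  also have "\<dots> = coeff (smult (real (Suc n) * (b - c) / c) (hyp_neg n b (c+1))) k"
  proof (cases "k \<le> n")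
    case True
    have nz: "pochhammer c (Suc k) \<noteq> 0" "pochhammer c k \<noteq> 0" using assms pochhammer_nonzero_mono True by auto
    hence ck: "c + real k \<noteq> 0" by (simp add: pochhammer_Suc)
    have ab: "real (Suc k) * real (Suc n choose Suc k) = real (Suc n) * real (n choose k)"
      by (metis Suc_times_binomial_eq mult.commute of_nat_mult)
    have "(Suc n - k) * (Suc n choose k) = Suc n * (n choose k)"
      using binomial_absorb_comp[of "Suc n" k] by simp
    hence ac: "(real (Suc n) - real k) * real (Suc n choose k) = real (Suc n) * real (n choose k)"
      using True by (metis le_SucI of_nat_diff of_nat_mult)
    have "real (Suc k) * coeff ?p (Suc k) = real (Suc n) * real (n choose k) * (pochhammer b (Suc k) / pochhammer c (Suc k))"
      unfolding coeff_hyp_neg ab[symmetric] by simp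
    moreover have "(real k - real (Suc n)) * coeff ?p k = - real (Suc n) * real (n choose k) * (pochhammer b k / pochhammer c k)"
    proof -
      have "(real k - real (Suc n)) * real (Suc n choose k) = - (real (Suc n) * real (n choose k))"
        using ac by (simp add: left_diff_distrib)
      thus ?thesis unfolding coeff_hyp_neg by (metis mult.assoc mult_minus_left times_divide_eq_right)
    qed
    moreover have "pochhammer b (Suc k) / pochhammer c (Suc k) - pochhammer b k / pochhammer c k
        = (b - c) / c * pochhammer b k / pochhammer (c + 1) k"
    proof -
      have r: "c * pochhammer (c+1) k = pochhammer c k * (c + real k)"
        by (metis pochhammer_Suc pochhammer_rec)
      have "pochhammer b (Suc k) / pochhammer c (Suc k) - pochhammer b k / pochhammer c k
        = (b - c) * pochhammer b k / (pochhammer c k * (c + real k))"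
        using nz ck by (simp add: pochhammer_Suc divide_simps) (simp add: algebra_simps)
      thus ?thesis by (simp add: r[symmetric])
    qed
    ultimately have "real (Suc k) * coeff ?p (Suc k) + (real k - real (Suc n)) * coeff ?p k
        = real (Suc n) * real (n choose k) * ((b - c) / c * pochhammer b k / pochhammer (c + 1) k)"
      by (metis (no_types) add_uminus_conv_diff mult_minus_left right_diff_distrib)
    thus ?thesis by (simp add: coeff_hyp_neg)
  next
    case False thus ?thesis by (cases "k = Suc n") (auto simp: coeff_hyp_neg binomial_eq_0)
  qed
  finally show "coeff ([:1,1:] * pderiv ?p - smult (real (Suc n)) ?p) k
     = coeff (smult (real (Suc n) * (b - c) / c) (hyp_neg n b (c+1))) k" .
qed

section \<open>Signs of the coefficients\<close>

text \<open>
  The number of negative factors of \<open>(a)\<^sub>n\<close>. As the factors increase, these are the first ones.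
\<close>
definition neg_factors :: "nat \<Rightarrow> real \<Rightarrow> nat" where
  "neg_factors n a = card {k. k < n \<and> a + real k < 0}"

lemma neg_factors_Suc: "neg_factors (Suc n) a = neg_factors n a + (if a + real n < 0 then 1 else 0)"
proof -
  have "{k. k < Suc n \<and> a + real k < 0} = {k. k < n \<and> a + real k < 0} \<union> (if a + real n < 0 then {n} else {})"
    by (auto simp: less_Suc_eq)
  thus ?thesis by (simp add: neg_factors_def)
qed

lemma neg_factors_0 [simp]: "neg_factors 0 a = 0" by (simp add: neg_factors_def)

lemma neg_factors_le: "neg_factors n a \<le> n"
  by (induction n) (auto simp: neg_factors_Suc)

lemma neg_factor_iff: "l < n \<Longrightarrow> a + real l < 0 \<longleftrightarrow> l < neg_factors n a"
proof (induction n)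
  case (Suc n)
  show ?case
  proof (cases "a + real n < 0")
    case True
    have "{k. k < Suc n \<and> a + real k < 0} = {..<Suc n}" using True by force
    thus ?thesis using True Suc.prems by (simp add: neg_factors_def)
  next
    case False
    thus ?thesis using Suc neg_factors_le[of n a] by (cases "l = n") (auto simp: neg_factors_Suc)
  qed
qed simp

text \<open>
  Here the first factor is split off instead of the last one: this describes the step from
  \<open>(n, c + 1)\<close> to \<open>(n + 1, c)\<close>.
\<close>
lemma neg_factors_shift: "neg_factors (Suc n) a = neg_factors n (a + 1) + (if a < 0 then 1 else 0)"
  by (induction n) (auto simp: neg_factors_Suc add_ac)

lemma sgn_pochhammer: "pochhammer a n \<noteq> 0 \<Longrightarrow> sgn (pochhammer a n) = (-1) ^ neg_factors n (a::real)"
proof (induction n)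
  case (Suc n)
  hence "pochhammer a n \<noteq> 0" "a + real n \<noteq> 0" by (auto simp: pochhammer_Suc)
  thus ?case using Suc.IH by (cases "a + real n < 0") (auto simp: pochhammer_Suc sgn_mult neg_factors_Suc)
qed simp

text \<open>
  The quotient of the \<open>k\<close>-th factors of numerator and denominator is negative exactly for
  \<open>k\<close> from \<open>neg_factors n c\<close> up to, but excluding, \<open>neg_factors n b\<close>. So the coefficients change
  sign from \<open>k\<close> to \<open>k + 1\<close> for these \<open>k\<close> only, as does the product of the linear functions with
  zeros at the midpoints \<open>k + 1/2\<close>.
\<close>
lemma sign_pattern_coeff:
  assumes b: "pochhammer b n \<noteq> 0" and c: "pochhammer c n \<noteq> 0" and le: "neg_factors n c \<le> neg_factors n b" and k: "k \<le> n"
  shows "pochhammer b k / pochhammer c k * (\<Prod>t\<in>{neg_factors n c..<neg_factors n b}. real t + 1/2 - real k) > 0"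
  using k
proof (induction k)
  case 0
  show ?case by (simp add: prod_pos)
next
  case (Suc k)
  let ?S = "{neg_factors n c..<neg_factors n b}"
  define r where "r = (b + real k) / (c + real k)"
  have nz: "b + real k \<noteq> 0" "c + real k \<noteq> 0"
    using pochhammer_nonzero_mono[OF b Suc.prems] pochhammer_nonzero_mono[OF c Suc.prems] by (auto simp: pochhammer_Suc)
  have "r < 0 \<longleftrightarrow> k \<in> ?S" and r0: "r \<noteq> 0"
    using nz neg_factor_iff[of k n b] neg_factor_iff[of k n c] Suc.prems le
    by (auto simp: r_def divide_less_0_iff not_less)
  \<comment> \<open>The product at \<open>k\<close> and the product at \<open>k + 1\<close> have factors of equal sign, except at \<open>t = k\<close>.\<close>
  have near: "(real t + 1/2 - real k) * (real t + 1/2 - real (Suc k)) > 0" if "t \<noteq> k" for t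
    using that by (cases "t < k") (auto simp: zero_less_mult_iff)
  have pos: "r * ((\<Prod>t\<in>?S. real t + 1/2 - real k) * (\<Prod>t\<in>?S. real t + 1/2 - real (Suc k))) > 0"
  proof (cases "k \<in> ?S")
    case True
    have "(\<Prod>t\<in>?S. (real t + 1/2 - real k) * (real t + 1/2 - real (Suc k)))
       = - 1/4 * (\<Prod>t\<in>?S - {k}. (real t + 1/2 - real k) * (real t + 1/2 - real (Suc k)))"
      using True by (subst prod.remove[of _ k]) auto
    moreover have "(\<Prod>t\<in>?S - {k}. (real t + 1/2 - real k) * (real t + 1/2 - real (Suc k))) > 0"
      by (rule prod_pos) (use near in blast)
    ultimately have "(\<Prod>t\<in>?S. (real t + 1/2 - real k) * (real t + 1/2 - real (Suc k))) < 0" by simp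
    thus ?thesis using True \<open>r < 0 \<longleftrightarrow> k \<in> ?S\<close> by (simp add: prod.distrib[symmetric] mult_neg_neg)
  next
    case False
    have "(\<Prod>t\<in>?S. (real t + 1/2 - real k) * (real t + 1/2 - real (Suc k))) > 0"
    proof (rule prod_pos)
      fix t assume "t \<in> ?S"
      hence "t \<noteq> k" using False by blast
      thus "(real t + 1/2 - real k) * (real t + 1/2 - real (Suc k)) > 0" by (rule near)
    qed
    moreover have "r > 0" using False \<open>r < 0 \<longleftrightarrow> k \<in> ?S\<close> r0 by linarith
    ultimately show ?thesis unfolding prod.distrib[symmetric] by (rule mult_pos_pos[rotated])
  qed
  have IH: "pochhammer b k / pochhammer c k * (\<Prod>t\<in>?S. real t + 1/2 - real k) > 0"
    using Suc by simp
  have "0 < (pochhammer b k / pochhammer c k * (\<Prod>t\<in>?S. real t + 1/2 - real k)) *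
     (r * ((\<Prod>t\<in>?S. real t + 1/2 - real k) * (\<Prod>t\<in>?S. real t + 1/2 - real (Suc k))))"
    using IH pos by (rule mult_pos_pos)
  also have "\<dots> = (pochhammer b (Suc k) / pochhammer c (Suc k) * (\<Prod>t\<in>?S. real t + 1/2 - real (Suc k)))
      * (\<Prod>t\<in>?S. real t + 1/2 - real k) ^ 2"
    by (simp add: r_def pochhammer_Suc power2_eq_square)
  finally show ?case by (metis mult_less_0_iff not_less_iff_gr_or_eq zero_le_power2 zero_less_mult_iff linorder_not_le)
qed

section \<open>Positive zeros of the hypergeometric polynomial\<close>

lemma finite_pos_zeros_hyp_neg [simp]: "finite (pos_zeros (hyp_neg n b c))"
  using poly_roots_finite[of "hyp_neg n b c"] by auto

lemma card_pos_zeros_hyp_neg_le: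
  assumes b: "pochhammer b n \<noteq> 0" and c: "pochhammer c n \<noteq> 0" and le: "neg_factors n c \<le> neg_factors n b"
  shows "card (pos_zeros (hyp_neg n b c)) \<le> neg_factors n b - neg_factors n c"
proof -
  define ss where "ss = map (\<lambda>t. real t + 1/2) [neg_factors n c..<neg_factors n b]"
  have e: "(\<Prod>s\<leftarrow>ss. s - real k) = (\<Prod>t\<in>{neg_factors n c..<neg_factors n b}. real t + 1/2 - real k)" for k
    by (simp add: ss_def o_def prod.distinct_set_conv_list[symmetric])
  have pos: "coeff (hyp_neg n b c) k * (\<Prod>s\<leftarrow>ss. s - real k) > 0" if "k \<le> n" for k
    using mult_pos_pos[OF _ sign_pattern_coeff[OF b c le that], of "real (n choose k)"] that
    by (simp add: e coeff_hyp_neg zero_less_binomial mult_ac)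
  have "card (pos_zeros (hyp_neg n b c)) \<le> length ss"
  proof (rule descartes_sign_bound)
    show "coeff (hyp_neg n b c) k * (\<Prod>s\<leftarrow>ss. s - real k) \<ge> 0" for k
      using pos[of k] by (cases "k \<le> n") (auto simp: coeff_hyp_neg binomial_eq_0)
    show "coeff (hyp_neg n b c) 0 * prod_list ss > 0" using pos[of 0] by simp
  qed
  thus ?thesis by (simp add: ss_def)
qed

text \<open>
  The factor \<open>(1 + w)\<^bsup>b - c\<^esup>\<close> behaves like \<open>w\<^bsup>b - c\<^esup>\<close>, so the product behaves like \<open>w\<^bsup>b + k\<^esup>\<close>.
\<close>
lemma weighted_power_tendsto_0:
  assumes "b + real k < 0"
  shows "((\<lambda>w. w powr c * (1 + w) powr (b - c) * w ^ k) \<longlongrightarrow> (0::real)) at_top"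
proof -
  have "((\<lambda>w::real. (1 + w) / w) \<longlongrightarrow> 1) at_top"
  proof (rule Lim_transform_eventually)
    show "((\<lambda>w::real. inverse w + 1) \<longlongrightarrow> 1) at_top"
      using tendsto_add[OF tendsto_inverse_0_at_top[OF filterlim_ident] tendsto_const[of 1]] by simp
    show "\<forall>\<^sub>F w::real in at_top. inverse w + 1 = (1 + w) / w"
      using eventually_gt_at_top[of 0] by (rule eventually_mono) (simp add: field_simps)
  qed
  hence "((\<lambda>w. w powr (b + real k) * ((1 + w) / w) powr (b - c)) \<longlongrightarrow> 0 * 1 powr (b - c)) at_top"
    by (intro tendsto_mult tendsto_neg_powr assms filterlim_ident tendsto_powr tendsto_const) auto
  moreover have "w powr (b + real k) * ((1 + w) / w) powr (b - c) = w powr c * (1 + w) powr (b - c) * w ^ k"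
    if "w > 0" for w
    using that by (simp add: powr_divide powr_add powr_diff powr_realpow field_simps)
  hence "\<forall>\<^sub>F w in at_top. w powr (b + real k) * ((1 + w) / w) powr (b - c) = w powr c * (1 + w) powr (b - c) * w ^ k"
    using eventually_gt_at_top[of 0] by (rule eventually_mono[rotated])
  ultimately show ?thesis by (simp add: filterlim_cong)
qed

text \<open>
  Induction on \<open>n\<close>, from \<open>(n, c + 1)\<close> to \<open>(n + 1, c)\<close>. Rolle's theorem loses one zero, which is made
  good by an additional zero of the weighted polynomial at 0 if \<open>c > 0\<close> (while for \<open>c < 0\<close> one more
  negative factor of \<open>(c)\<^sub>n\<close> appears), and there is a gain at infinity if \<open>b + n < 0\<close> (when one more
  negative factor of \<open>(b)\<^sub>n\<close> appears).
\<close>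
lemma card_pos_zeros_hyp_neg_ge:
  assumes "pochhammer b n \<noteq> 0" and "pochhammer c n \<noteq> 0"
  shows "neg_factors n b \<le> card (pos_zeros (hyp_neg n b c)) + neg_factors n c"
  using assms
proof (induction n arbitrary: c)
  case (Suc n)
  define P where "P = hyp_neg n b (c+1)"
  define f where "f = (\<lambda>w. w powr c * (1 + w) powr (b - c) * poly P w)"
  define f' where "f' = (\<lambda>w. w powr (c-1) * (1 + w) powr (b - c - 1) * (c * poly (hyp_neg (Suc n) b c) w))"
  have c0: "c \<noteq> 0" and c1: "pochhammer (c+1) n \<noteq> 0" using Suc.prems by (auto simp: pochhammer_rec)
  have b1: "pochhammer b n \<noteq> 0" "b + real n \<noteq> 0" using Suc.prems by (auto simp: pochhammer_Suc)
  define Z where "Z = pos_zeros P \<union> (if c > 0 then {0} else {})"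
  have cZ: "card Z = card (pos_zeros P) + (if c > 0 then 1 else 0)" by (simp add: Z_def P_def)
  have fin: "finite Z" "finite (pos_zeros (hyp_neg (Suc n) b c))" by (auto simp: Z_def P_def)
  have fZ: "0 \<le> z \<and> f z = 0 \<and> continuous_on {z..} f" if "z \<in> Z" for z
  proof -
    have z: "z \<ge> 0" "z = 0 \<longrightarrow> c > 0" using that by (auto simp: Z_def split: if_splits)
    hence "continuous_on {z..} f" unfolding f_def
      by (intro continuous_intros continuous_on_powr') auto
    thus ?thesis using z that by (auto simp: f_def Z_def split: if_splits)
  qed
  have der: "(f has_real_derivative f' w) (at w)" if w: "w > 0" for w
  proof -
    have "(f has_real_derivative
        (c * w powr (c - 1) * (1 + w) powr (b - c) + w powr c * ((b - c) * (1 + w) powr (b - c - 1))) * poly P w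
        + w powr c * (1 + w) powr (b - c) * poly (pderiv P) w) (at w)"
      unfolding f_def using w
      by (auto intro!: derivative_eq_intros has_real_derivative_powr simp: algebra_simps)
    moreover have "w powr c = w powr (c - 1) * w" "(1+w) powr (b - c) = (1+w) powr (b - c - 1) * (1+w)"
      using w powr_add[of w "c-1" 1] powr_add[of "1+w" "b-c-1" 1] by auto
    moreover have "f' w = w powr (c-1) * (1 + w) powr (b - c - 1) *
       ((c * (1 + w) + (b - c) * w) * poly P w + w * (1 + w) * poly (pderiv P) w)"
      unfolding f'_def P_def poly_hyp_neg_raise[OF Suc.prems(2)] by (simp add: algebra_simps)
    ultimately show ?thesis by (simp add: algebra_simps)
  qed
  have W: "w \<in> pos_zeros (hyp_neg (Suc n) b c)" if "w > 0" "f' w = 0" for w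
    using that c0 by (simp add: f'_def)
  have r1: "card Z \<le> card (pos_zeros (hyp_neg (Suc n) b c)) + 1"
    by (rule card_zeros_le_card_deriv_zeros(1)[OF fin, of f f']) (use fZ der W in blast)+
  have r2: "card Z \<le> card (pos_zeros (hyp_neg (Suc n) b c))" if lim: "(f \<longlongrightarrow> 0) at_top"
    by (rule card_zeros_le_card_deriv_zeros(2)[OF fin, of f f']) (use fZ der W lim in blast)+
  have "card Z + (if b + real n < 0 then 1 else 0) \<le> card (pos_zeros (hyp_neg (Suc n) b c)) + 1"
  proof (cases "b + real n < 0")
    case True
    have "(f \<longlongrightarrow> (\<Sum>k\<le>n. coeff P k * 0)) at_top"
    proof -
      have "f = (\<lambda>w. \<Sum>k\<le>n. coeff P k * (w powr c * (1 + w) powr (b - c) * w ^ k))"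
        by (auto simp: f_def P_def poly_hyp_neg coeff_hyp_neg sum_distrib_left mult_ac)
      thus ?thesis using True
        by (auto intro!: tendsto_sum tendsto_mult_left weighted_power_tendsto_0 simp del: mult_zero_right)
    qed
    hence "(f \<longlongrightarrow> 0) at_top" by (simp only: mult_zero_right sum.neutral_const)
    from r2[OF this] True show ?thesis by simp
  qed (use r1 in simp)
  with Suc.IH[OF b1(1) c1] cZ c0 show ?case
    by (auto simp: neg_factors_Suc[of n b] neg_factors_shift[of n c] P_def split: if_splits)
qed simp

text \<open>
  By the two contiguous relations, a double zero for \<open>(n + 1, c)\<close> is also one for \<open>(n, c + 1)\<close>, and
  hence by descent one of the constant 1. If \<open>b = c\<close> the descent breaks off, but then the polynomial
  is \<open>(1 + w)\<close> to the power \<open>n + 1\<close>.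
\<close>
lemma hyp_neg_pos_zeros_simple:
  assumes "pochhammer c n \<noteq> 0" "x > 0" "poly (hyp_neg n b c) x = 0"
  shows "poly (pderiv (hyp_neg n b c)) x \<noteq> 0"
  using assms
proof (induction n arbitrary: c)
  case (Suc n)
  have c0: "c \<noteq> 0" using Suc.prems by (auto simp: pochhammer_rec)
  show ?case
  proof
    assume d: "poly (pderiv (hyp_neg (Suc n) b c)) x = 0"
    show False
    proof (cases "b = c")
      case True
      have "coeff (hyp_neg (Suc n) b c) k \<ge> 0" for k
        using pochhammer_nonzero_mono[OF Suc.prems(1), of k] by (cases "k \<le> Suc n") (auto simp: coeff_hyp_neg True binomial_eq_0)
      hence "poly (hyp_neg (Suc n) b c) x > 0" using Suc.prems by (intro poly_pos_if_coeffs_nonneg) auto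
      thus False using Suc.prems by simp
    next
      case False
      have z: "poly (hyp_neg n b (c+1)) x = 0"
        using arg_cong[OF hyp_neg_lower[OF Suc.prems(1), of b], of "\<lambda>p. poly p x"] d Suc.prems False c0 by simp
      moreover have "x * (1 + x) * poly (pderiv (hyp_neg n b (c+1))) x = 0"
        using poly_hyp_neg_raise[OF Suc.prems(1), of x b] z Suc.prems(3) by (simp only: mult_zero_right diff_self)
      hence "poly (pderiv (hyp_neg n b (c+1))) x = 0"
        using Suc.prems(2) by (metis add_pos_pos mult_eq_0_iff order_less_irrefl zero_less_one)
      moreover have "pochhammer (c+1) n \<noteq> 0" using Suc.prems by (auto simp: pochhammer_rec)
      ultimately show False using Suc.IH Suc.prems by blast
    qed
  qed
qed simp

text \<open>
  With \<open>P\<close> and \<open>H\<close> the two polynomials that the contiguous relations connect, a suitable positive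
  weight makes the derivative of weight times \<open>P H\<close> a positive multiple of
  \<open>H\<^sup>2 + (n + 1) (b - c) w P\<^sup>2\<close>. For \<open>b > c\<close> it is positive, so \<open>P H\<close> vanishes only once.
\<close>
lemma hyp_neg_at_most_one_pos_zero:
  assumes c: "pochhammer c (Suc n) \<noteq> 0" and bc: "b > c" and xy: "0 < x" "x < y"
    and zx: "poly (hyp_neg n b (c+1)) x = 0" and zy: "poly (hyp_neg n b (c+1)) y = 0"
  shows False
proof -
  define P where "P = hyp_neg n b (c+1)"
  define H where "H = smult c (hyp_neg (Suc n) b c)"
  \<comment> \<open>The exponent combines \<open>b - c\<close> from the raising relation with \<open>-(n + 1)\<close> from the lowering one.\<close>
  define s where "s = b - c - real n - 1"
  define V where "V = (\<lambda>w. w powr c * (1 + w) powr s * (poly P w * poly H w))"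
  define D where "D = (\<lambda>w. w powr (c - 1) * (1 + w) powr (s - 1) * (poly H w ^ 2 + (real n + 1) * (b - c) * w * poly P w ^ 2))"
  have c0: "c \<noteq> 0" using c by (auto simp: pochhammer_rec)
  have R: "w * (1 + w) * poly (pderiv P) w = poly H w - (c + b * w) * poly P w" for w
    using poly_hyp_neg_raise[OF c, of w b] by (simp add: P_def H_def)
  have L: "(1 + w) * poly (pderiv H) w = (real n + 1) * poly H w + (real n + 1) * (b - c) * poly P w" for w
  proof -
    let ?Q = "hyp_neg (Suc n) b c"
    have e: "(1 + w) * poly (pderiv ?Q) w - (real n + 1) * poly ?Q w = (real n + 1) * (b - c) / c * poly P w"
      using arg_cong[OF hyp_neg_lower[OF c, of b], of "\<lambda>p. poly p w"] by (simp add: P_def algebra_simps)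
    have "(1 + w) * poly (pderiv H) w - (real n + 1) * poly H w
        = c * ((1 + w) * poly (pderiv ?Q) w - (real n + 1) * poly ?Q w)"
      by (simp add: H_def pderiv_smult algebra_simps)
    also have "\<dots> = (real n + 1) * (b - c) * poly P w" unfolding e using c0 by simp
    finally show ?thesis by simp
  qed
  have V: "(V has_real_derivative D w) (at w)" if w: "w > 0" for w
  proof -
    have "(V has_real_derivative
        (c * w powr (c - 1) * (1 + w) powr s + w powr c * (s * (1 + w) powr (s - 1))) * (poly P w * poly H w)
        + w powr c * (1 + w) powr s * (poly (pderiv P) w * poly H w + poly P w * poly (pderiv H) w)) (at w)"
      unfolding V_def using w
      by (auto intro!: derivative_eq_intros has_real_derivative_powr simp: algebra_simps)
    moreover have "w powr c = w powr (c - 1) * w" "(1+w) powr s = (1+w) powr (s-1) * (1+w)"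
      using w powr_add[of w "c-1" 1] powr_add[of "1+w" "s-1" 1] by auto
    moreover have "D w = w powr (c - 1) * (1 + w) powr (s - 1) * ((c * (1+w) + s * w) * (poly P w * poly H w)
        + (w * (1+w) * poly (pderiv P) w) * poly H w + w * poly P w * ((1+w) * poly (pderiv H) w))"
      unfolding R L D_def s_def by (simp add: algebra_simps power2_eq_square)
    ultimately show ?thesis by (simp add: algebra_simps)
  qed
  have pos: "D w > 0" if w: "w > 0" for w
  proof -
    have "poly H w \<noteq> 0 \<or> poly P w \<noteq> 0"
    proof (rule ccontr)
      assume "\<not> ?thesis"
      hence h: "poly H w = 0" "poly P w = 0" by auto
      have "pochhammer (c+1) n \<noteq> 0" using c by (auto simp: pochhammer_rec)
      hence "poly (pderiv P) w \<noteq> 0" using hyp_neg_pos_zeros_simple w h(2) unfolding P_def by blast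
      thus False using R[of w] h w by simp
    qed
    moreover have "(real n + 1) * (b - c) * w > 0" using bc w by simp
    ultimately have "poly H w ^ 2 + (real n + 1) * (b - c) * w * poly P w ^ 2 > 0"
      by (metis add_nonneg_pos add_pos_nonneg less_eq_real_def mult_nonneg_nonneg mult_pos_pos zero_le_power2 zero_less_power2)
    thus ?thesis using w by (simp add: D_def)
  qed
  have "V x < V y"
    by (rule DERIV_pos_imp_increasing[OF xy(2)]) (use V pos xy in \<open>meson order_less_le_trans\<close>)
  thus False using zx zy by (simp add: V_def P_def)
qed

text \<open>
  If there are more negative factors in \<open>(c)\<^sub>n\<close> than in \<open>(b)\<^sub>n\<close>, then \<open>c < b\<close> and there is at most one
  zero. The value at 0 is 1 and the leading coefficient has the sign of \<open>(b)\<^sub>n (c)\<^sub>n\<close>. If this is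
  negative, the intermediate value theorem gives a zero; if it is positive, a single zero would be a
  minimum, hence a double zero.
\<close>
theorem card_pos_zeros_hyp_neg:
  assumes b: "pochhammer b n \<noteq> 0" and c: "pochhammer c n \<noteq> 0"
  shows "card (pos_zeros (hyp_neg n b c)) = 
    (if neg_factors n c \<le> neg_factors n b then neg_factors n b - neg_factors n c else (neg_factors n b + neg_factors n c) mod 2)"
proof (cases "neg_factors n c \<le> neg_factors n b")
  case True
  thus ?thesis using card_pos_zeros_hyp_neg_le[OF b c True] card_pos_zeros_hyp_neg_ge[OF b c] by simp
next
  case False
  define P where "P = hyp_neg n b c"
  define k where "k = neg_factors n b"
  have kn: "k < n" using False neg_factors_le[of n c] by (simp add: k_def)
  have k: "c + real k < 0" "b + real k \<ge> 0"
    using neg_factor_iff[OF kn, of b] neg_factor_iff[OF kn, of c] False by (auto simp: k_def)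
  have c': "pochhammer (c - 1) (Suc n) \<noteq> 0" using k c by (simp add: pochhammer_rec)
  have one: "x = y" if "x \<in> pos_zeros P" "y \<in> pos_zeros P" for x y
    using hyp_neg_at_most_one_pos_zero[OF c', of b x y] hyp_neg_at_most_one_pos_zero[OF c', of b y x] that k
    by (cases x y rule: linorder_cases) (auto simp: P_def)
  have lc: "coeff P n = pochhammer b n / pochhammer c n" by (simp add: P_def coeff_hyp_neg)
  have deg: "degree P = n"
    using lc b c by (intro antisym degree_le le_degree) (auto simp: P_def coeff_hyp_neg binomial_eq_0)
  have sg: "sgn (lead_coeff P) = (-1) ^ (neg_factors n b + neg_factors n c)"
    using sgn_pochhammer[OF b] sgn_pochhammer[OF c] unfolding deg lc
    by (simp add: sgn_divide power_add) (metis divide_minus1 div_by_1 minus_one_power_iff mult_minus1_right mult.right_neutral)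
  have P0: "poly P 0 = 1" by (simp add: P_def poly_0_coeff_0)
  have "card (pos_zeros P) = (neg_factors n b + neg_factors n c) mod 2"
  proof (cases "even (neg_factors n b + neg_factors n c)")
    case False
    hence "sgn (lead_coeff P) = -1" using sg by simp
    hence "lead_coeff P < 0" by (simp only: sgn_1_neg)
    then obtain x where "x \<in> pos_zeros P" using pos_root_if_lead_neg[of P 0] P0 by auto
    hence "pos_zeros P = {x}" using one by blast
    thus ?thesis using False by (metis is_singletonI is_singleton_altdef odd_iff_mod_2_eq_one)
  next
    case True
    hence "sgn (lead_coeff P) = 1" using sg by simp
    hence lp: "lead_coeff P > 0" by (simp only: sgn_1_pos)
    have "pos_zeros P = {}"
    proof (rule ccontr)
      assume "pos_zeros P \<noteq> {}"
      then obtain x where x: "x > 0" "poly P x = 0" by auto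
      have no: "poly P y \<noteq> 0" if "y > 0" "y \<noteq> x" for y using one[of x y] x that by auto
      have nonneg: "poly P x \<le> poly P y" if y: "\<bar>x - y\<bar> < x" for y
      proof (rule ccontr)
        assume "\<not> ?thesis"
        hence neg: "poly P y < 0" using x by simp
        have "y > 0" using y by (simp add: abs_if split: if_splits)
        show False
        proof (cases "y < x")
          case True
          obtain z where "0 < z" "z < y" "poly P z = 0"
            using poly_IVT_neg[of 0 y P] P0 neg \<open>y > 0\<close> by auto
          thus False using no[of z] True by simp
        next
          case False
          obtain z where "z > y" "poly P z = 0"
            using pos_root_if_lead_neg[of "- P" y] lp neg by auto
          thus False using no[of z] False \<open>y > 0\<close> by simp
        qed
      qed
      have "poly (pderiv P) x = 0"
        by (rule DERIV_local_min[OF poly_DERIV x(1)]) (use nonneg in blast)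
      thus False using hyp_neg_pos_zeros_simple[OF c x(1)] x(2) by (simp add: P_def)
    qed
    thus ?thesis using True by (metis card.empty even_iff_mod_2_eq_zero)
  qed
  thus ?thesis using False by (simp add: P_def)
qed

section \<open>Moebius transformations\<close>

lemma pderiv_hyp_neg:
  "pderiv (hyp_neg (Suc n) b c) = smult (real (Suc n) * b / c) (hyp_neg n (b + 1) (c + 1))"
proof (rule poly_eqI)
  fix k
  have "real (Suc k) * real (Suc n choose Suc k) = real (Suc n) * real (n choose k)"
    by (metis Suc_times_binomial_eq mult.commute of_nat_mult)
  hence "coeff (pderiv (hyp_neg (Suc n) b c)) k = real (Suc n) * real (n choose k) * pochhammer b (Suc k) / pochhammer c (Suc k)"
    unfolding coeff_pderiv coeff_hyp_neg by (metis mult.assoc times_divide_eq_right)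
  also have "\<dots> = coeff (smult (real (Suc n) * b / c) (hyp_neg n (b + 1) (c + 1))) k"
    by (simp add: coeff_hyp_neg pochhammer_rec)
  finally show "coeff (pderiv (hyp_neg (Suc n) b c)) k = \<dots>" .
qed

text \<open>
  The Chu-Vandermonde identity for \<open>F(-n, b; c; 1)\<close>.
\<close>
lemma hyp_neg_minus_one:
  assumes "pochhammer c n \<noteq> 0"
  shows "poly (hyp_neg n b c) (-1) = pochhammer (c - b) n / pochhammer c n"
proof -
  have "\<forall>i\<in>{0..<n}. c \<noteq> - of_nat i" using assms by (auto simp: pochhammer_eq_0_iff)
  from Vandermonde_pochhammer[OF this, of b]
  have "pochhammer (c - b) n / pochhammer c n
     = (\<Sum>k=0..n. (pochhammer b k * pochhammer (- real n) k) / (fact k * pochhammer c k))" by simp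
  also have "\<dots> = poly (hyp_neg n b c) (-1)"
    unfolding poly_hyp_neg atMost_atLeast0
    by (intro sum.cong refl) (simp add: binomial_gbinomial gbinomial_pochhammer field_simps)
  finally show ?thesis ..
qed

text \<open>
  This is \<open>F(-n, b; c; 1 + w)\<close> as a multiple of \<open>F(-n, b; b - n + 1 - c; -w)\<close>. By induction on \<open>n\<close>
  the derivatives of both sides agree, since differentiation raises \<open>b\<close> and both third parameters
  by 1; at \<open>w = 0\<close> both sides agree by Chu-Vandermonde.
\<close>
lemma hyp_neg_reflect:
  assumes "pochhammer c n \<noteq> 0" "pochhammer (b - real n + 1 - c) n \<noteq> 0"
  shows "pcompose (hyp_neg n b c) [:-1, -1:]
       = smult (pochhammer (c - b) n / pochhammer c n) (hyp_neg n b (b - real n + 1 - c))"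
  using assms
proof (induction n arbitrary: b c)
  case (Suc n)
  define d where "d = b - real (Suc n) + 1 - c"
  define \<kappa> where "\<kappa> = pochhammer (c - b) (Suc n) / pochhammer c (Suc n)"
  define D where "D = pcompose (hyp_neg (Suc n) b c) [:-1, -1:] - smult \<kappa> (hyp_neg (Suc n) b d)"
  have c: "c \<noteq> 0" "pochhammer (c + 1) n \<noteq> 0" using Suc.prems(1) by (auto simp: pochhammer_rec)
  have "pochhammer d (Suc n) \<noteq> 0" unfolding d_def by (rule Suc.prems(2))
  hence d: "d \<noteq> 0" "pochhammer (d + 1) n \<noteq> 0" by (auto simp: pochhammer_rec)
  have d1: "b + 1 - real n + 1 - (c + 1) = d + 1" by (simp add: d_def)
  have IH: "pcompose (hyp_neg n (b+1) (c+1)) [:-1, -1:] = smult (pochhammer (c - b) n / pochhammer (c + 1) n) (hyp_neg n (b+1) (d+1))"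
    using Suc.IH[of "c+1" "b+1", unfolded d1, OF c(2) d(2)] by simp
  have k: "\<kappa> / d = - (pochhammer (c - b) n / pochhammer (c + 1) n) / c"
  proof -
    have "c - b + real n = - d" by (simp add: d_def)
    hence "\<kappa> = d * (- (pochhammer (c - b) n / pochhammer (c + 1) n) / c)"
      by (simp add: \<kappa>_def pochhammer_rec[of c] pochhammer_Suc[of "c-b"] mult_ac)
    thus ?thesis using d(1) by simp
  qed
  have "pderiv D = smult (- (real (Suc n) * b / c) * (pochhammer (c - b) n / pochhammer (c + 1) n) 
      - real (Suc n) * b * (\<kappa> / d)) (hyp_neg n (b+1) (d+1))"
    by (simp add: D_def pderiv_diff pderiv_smult pderiv_pcompose pderiv_hyp_neg pcompose_smult IH pderiv_pCons
        smult_diff_left mult_ac)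
  also have "\<dots> = 0" unfolding k by simp
  finally obtain h where h: "D = [:h:]" using pderiv_iszero by blast
  have "poly D 0 = 0" using hyp_neg_minus_one[OF Suc.prems(1)]
    by (simp add: D_def poly_pcompose \<kappa>_def poly_0_coeff_0)
  hence "D = 0" using h by simp
  thus ?case by (simp add: D_def \<kappa>_def d_def)
qed (simp add: pcompose_1)

text \<open>
  Reversing the order of the coefficients gives again coefficients of this form, because \<open>(a)\<^bsub>n-k\<^esub>\<close> is
  \<open>(a)\<^sub>n\<close> divided by \<open>(-1)\<^sup>k (1 - a - n)\<^sub>k\<close>.
\<close>
lemma hyp_neg_reverse:
  assumes b: "pochhammer b n \<noteq> 0" and c: "pochhammer c n \<noteq> 0" and x: "x \<noteq> 0"
  shows "x ^ n * poly (hyp_neg n b c) (1 / x)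
     = pochhammer b n / pochhammer c n * poly (hyp_neg n (1 - c - real n) (1 - b - real n)) x"
proof -
  have split: "pochhammer a n = pochhammer a (n - k) * ((-1) ^ k * pochhammer (1 - a - real n) k)"
    if "k \<le> n" for k and a :: real
  proof -
    have "pochhammer (a + real (n - k)) k = (-1) ^ k * pochhammer (1 - a - real n) k"
      using pochhammer_minus'[of "a + real n - 1" k] that by (simp add: algebra_simps of_nat_diff)
    thus ?thesis using pochhammer_product[of "n - k" n a] that by simp
  qed
  have t: "x ^ n * (real (n choose k) * pochhammer b k / pochhammer c k * (1 / x) ^ k)
    = pochhammer b n / pochhammer c n * (real (n choose (n - k)) * pochhammer (1 - c - real n) (n - k)
        / pochhammer (1 - b - real n) (n - k) * x ^ (n - k))" if k: "k \<le> n" for k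
  proof -
    have B: "pochhammer b n = pochhammer b k * ((-1) ^ (n-k) * pochhammer (1 - b - real n) (n-k))"
     and C: "pochhammer c n = pochhammer c k * ((-1) ^ (n-k) * pochhammer (1 - c - real n) (n-k))"
      using split[of "n-k" b] split[of "n-k" c] k by auto
    have "x ^ n = x ^ (n-k) * x ^ k" using k by (simp flip: power_add)
    hence "x ^ n * (1 / x) ^ k = x ^ (n-k)" using x by (simp add: power_divide)
    moreover have "pochhammer b k / pochhammer c k
      = pochhammer b n / pochhammer c n * (pochhammer (1 - c - real n) (n - k) / pochhammer (1 - b - real n) (n - k))"
      using b c unfolding B C by (simp add: field_simps)
    moreover have "x ^ n * (real (n choose k) * pochhammer b k / pochhammer c k * (1 / x) ^ k)
      = real (n choose (n - k)) * (pochhammer b k / pochhammer c k) * (x ^ n * (1 / x) ^ k)"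
      using binomial_symmetric[OF k] by simp
    ultimately show ?thesis by (simp only: mult_ac times_divide_eq_right times_divide_eq_left divide_divide_eq_left)
  qed
  have "x ^ n * poly (hyp_neg n b c) (1 / x)
     = (\<Sum>k\<le>n. x ^ n * (real (n choose k) * pochhammer b k / pochhammer c k * (1 / x) ^ k))"
    by (simp add: poly_hyp_neg sum_distrib_left)
  also have "\<dots> = (\<Sum>k\<le>n. pochhammer b n / pochhammer c n * (real (n choose (n - k)) * pochhammer (1 - c - real n) (n - k)
        / pochhammer (1 - b - real n) (n - k) * x ^ (n - k)))"
    using t by (intro sum.cong) auto
  also have "\<dots> = (\<Sum>k\<le>n. pochhammer b n / pochhammer c n * (real (n choose k) * pochhammer (1 - c - real n) k
        / pochhammer (1 - b - real n) k * x ^ k))"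
    by (rule sum.reindex_bij_witness[of _ "\<lambda>k. n - k" "\<lambda>k. n - k"]) auto
  also have "\<dots> = pochhammer b n / pochhammer c n * poly (hyp_neg n (1 - c - real n) (1 - b - real n)) x"
    by (simp add: poly_hyp_neg sum_distrib_left)
  finally show ?thesis .
qed

lemma num_zeros_negative: "num_zeros (hypergeom_poly n b c) {..<0} = card (pos_zeros (hyp_neg n b c))"
proof -
  have "{z \<in> {..<0}. hypergeom_poly n b c z = 0} = uminus ` pos_zeros (hyp_neg n b c)"
    by (auto simp: hypergeom_poly_eq_hyp_neg image_iff intro!: exI[of _ "- x" for x])
  thus ?thesis by (simp add: num_zeros_def card_image)
qed

lemma num_zeros_gt_one:
  assumes c: "pochhammer c n \<noteq> 0" and d: "pochhammer (c - b) n \<noteq> 0" "pochhammer (b - real n + 1 - c) n \<noteq> 0"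
  shows "num_zeros (hypergeom_poly n b c) {1<..} = card (pos_zeros (hyp_neg n b (b - real n + 1 - c)))"
proof -
  have e: "hypergeom_poly n b c (1 + w) = pochhammer (c - b) n / pochhammer c n * poly (hyp_neg n b (b - real n + 1 - c)) w" for w
    using arg_cong[OF hyp_neg_reflect[OF c d(2)], of "\<lambda>p. poly p w"]
    by (simp add: hypergeom_poly_eq_hyp_neg poly_pcompose algebra_simps)
  have "hypergeom_poly n b c z = 0 \<longleftrightarrow> poly (hyp_neg n b (b - real n + 1 - c)) (z - 1) = 0" for z
    using e[of "z - 1"] c d by simp
  then obtain p where p: "p = hyp_neg n b (b - real n + 1 - c)"
    and iff: "\<And>z. hypergeom_poly n b c z = 0 \<longleftrightarrow> poly p (z - 1) = 0" by blast
  have "bij_betw (\<lambda>z. z - 1) {z \<in> {1<..}. hypergeom_poly n b c z = 0} (pos_zeros (hyp_neg n b (b - real n + 1 - c)))"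
    unfolding iff p[symmetric] by (rule bij_betw_byWitness[where f' = "\<lambda>w. w + 1"]) auto
  thus ?thesis unfolding num_zeros_def by (rule bij_betw_same_card)
qed

lemma num_zeros_unit_interval:
  assumes b: "pochhammer b n \<noteq> 0" and c: "pochhammer c n \<noteq> 0"
  shows "num_zeros (hypergeom_poly n b c) {0<..<1}
       = num_zeros (hypergeom_poly n (1 - c - real n) (1 - b - real n)) {1<..}"
proof -
  have "hypergeom_poly n b c z = 0 \<longleftrightarrow> hypergeom_poly n (1 - c - real n) (1 - b - real n) (1 / z) = 0" if "z \<noteq> 0" for z
  proof -
    have "(- 1 / z) ^ n * poly (hyp_neg n b c) (- z)
        = pochhammer b n / pochhammer c n * poly (hyp_neg n (1 - c - real n) (1 - b - real n)) (- 1 / z)"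
      using hyp_neg_reverse[OF b c, of "- 1 / z"] that by simp
    moreover have "(- 1 / z) ^ n \<noteq> 0" "pochhammer b n / pochhammer c n \<noteq> 0" using b c that by auto
    ultimately show ?thesis unfolding hypergeom_poly_eq_hyp_neg
      by (metis minus_divide_left mult_eq_0_iff)
  qed
  note iff = this
  have "bij_betw (\<lambda>z. 1 / z) {z \<in> {0<..<1}. hypergeom_poly n b c z = 0}
     {z \<in> {1<..}. hypergeom_poly n (1 - c - real n) (1 - b - real n) z = 0}"
  proof (rule bij_betw_byWitness[where f' = "\<lambda>z. 1 / z"])
    show "(\<lambda>z. 1 / z) ` {z \<in> {0<..<1}. hypergeom_poly n b c z = 0}
      \<subseteq> {z \<in> {1<..}. hypergeom_poly n (1 - c - real n) (1 - b - real n) z = 0}"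
      using iff by auto
    show "(\<lambda>z. 1 / z) ` {z \<in> {1<..}. hypergeom_poly n (1 - c - real n) (1 - b - real n) z = 0}
      \<subseteq> {z \<in> {0<..<1}. hypergeom_poly n b c z = 0}"
      using iff[of "1 / z" for z] by auto
  qed auto
  thus ?thesis unfolding num_zeros_def by (rule bij_betw_same_card)
qed

section \<open>Klein's symbol\<close>

text \<open>
  On positive reals Klein's symbol is the greatest integer strictly below the argument.
\<close>
lemma klein_E_between:
  assumes "d \<ge> 1" "real_of_int d - 1 < u" "u \<le> real_of_int d + 1"
  shows "klein_E u = d - 1 \<or> klein_E u = d"
proof (cases "u \<in> \<int>")
  case True
  then obtain k where "u = of_int k" by (auto elim: Ints_cases)
  thus ?thesis using assms by (auto simp: klein_E_def)
next
  case False
  hence "u \<noteq> of_int (d + 1)" by (metis Ints_of_int)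
  hence "u < of_int d + 1" using assms by simp
  hence "\<lfloor>u\<rfloor> = d - 1 \<or> \<lfloor>u\<rfloor> = d" using assms(2) by linarith
  thus ?thesis using assms False by (auto simp: klein_E_def)
qed

lemma klein_E_eq_0: "u \<le> 1 \<Longrightarrow> klein_E u = 0"
proof -
  assume u: "u \<le> 1"
  show ?thesis
  proof (cases "u = 1")
    case False
    thus ?thesis using u by (auto simp: klein_E_def floor_eq_iff elim!: Ints_cases)
  qed (simp add: klein_E_def)
qed

text \<open>
  Both \<open>2 * \<lfloor>(Z + 1) / 2\<rfloor>\<close> and \<open>2 * \<lfloor>Z / 2\<rfloor> + 1\<close> round \<open>Z\<close> up to the next number of the right parity.
  Hence it suffices that \<open>Z\<close> is \<open>d\<close> or \<open>d - 1\<close> if \<open>d = m - i\<close> is positive, and that \<open>Z = 0\<close> otherwise.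
  The number \<open>m\<close> of negative factors of \<open>(b)\<^sub>n\<close> determines the unit interval that contains \<open>b\<close>, or,
  for \<open>m = 0\<close> and \<open>m = n\<close>, the half-line; likewise for \<open>i\<close> and \<open>c\<close>.
\<close>
lemma card_pos_zeros_klein:
  assumes b: "pochhammer b n \<noteq> 0" and c: "pochhammer c n \<noteq> 0"
  defines "Z \<equiv> klein_E (1/2 * (- \<bar>1 - c\<bar> - \<bar>real n + b\<bar> + \<bar>b - c - real n\<bar> + 1))"
  shows "pochhammer b n * pochhammer c n > 0 \<Longrightarrow> int (card (pos_zeros (hyp_neg n b c))) = 2 * \<lfloor>(real_of_int Z + 1) / 2\<rfloor>"
    and "pochhammer b n * pochhammer c n < 0 \<Longrightarrow> int (card (pos_zeros (hyp_neg n b c))) = 2 * \<lfloor>real_of_int Z / 2\<rfloor> + 1"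
proof -
  define m where "m = neg_factors n b"
  define i where "i = neg_factors n c"
  define u where "u = 1/2 * (- \<bar>1 - c\<bar> - \<bar>real n + b\<bar> + \<bar>b - c - real n\<bar> + 1)"
  have le: "m \<le> n" "i \<le> n" by (auto simp: m_def i_def neg_factors_le)
  have bnd: "(neg_factors n a \<ge> 1 \<longrightarrow> a < 1 - real (neg_factors n a)) \<and> (neg_factors n a < n \<longrightarrow> a > - real (neg_factors n a))"
    if "pochhammer a n \<noteq> 0" for a
  proof -
    have "a + real (neg_factors n a) \<noteq> 0" if "neg_factors n a < n"
      using \<open>pochhammer a n \<noteq> 0\<close> that by (auto simp: pochhammer_eq_0_iff add_eq_0_iff2)
    moreover have "a + (real (neg_factors n a) - 1) < 0" if "neg_factors n a \<ge> 1"
      using neg_factor_iff[of "neg_factors n a - 1" n a] neg_factors_le[of n a] that by (simp add: of_nat_diff)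
    moreover have "a + real (neg_factors n a) \<ge> 0" if "neg_factors n a < n"
      using neg_factor_iff[OF that, of a] by simp
    ultimately show ?thesis by force
  qed
  have B: "m \<ge> 1 \<Longrightarrow> b < 1 - real m" "m < n \<Longrightarrow> b > - real m"
    and C: "i \<ge> 1 \<Longrightarrow> c < 1 - real i" "i < n \<Longrightarrow> c > - real i"
    using bnd[OF b] bnd[OF c] by (auto simp: m_def i_def)
  \<comment> \<open>Linear arithmetic treats the absolute values as unknowns with the bounds below.\<close>
  obtain A1 A2 A3 where A: "A1 = \<bar>1 - c\<bar>" "A2 = \<bar>real n + b\<bar>" "A3 = \<bar>b - c - real n\<bar>" by blast
  have u: "2 * u = - A1 - A2 + A3 + 1" by (simp add: u_def A)
  have A12: "A1 = 1 - c \<or> A1 = c - 1" "A2 = real n + b \<or> A2 = - (real n + b)"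
    "A1 \<ge> 1 - c" "A1 \<ge> c - 1" "A2 \<ge> real n + b" "A2 \<ge> - (real n + b)" by (auto simp: A)
  have A3: "A3 = b - c - real n \<or> A3 = c + real n - b" "A3 \<ge> c + real n - b" by (auto simp: A)
  have up: "u \<le> max (real m - real i) 0 + 1"
  proof -
    have "real m = real n \<or> b > - real m" "real i = 0 \<or> c < 1 - real i"
      using le B(2) C(1) by (cases "m = n"; cases "i = 0"; simp)+
    moreover have "real m \<le> real n" "real i \<le> real n" "real i \<ge> 0" using le by auto
    ultimately have "u \<le> M + 1" if "M \<ge> real m - real i" "M \<ge> 0" for M
      using u A3(1) A12(3-6) that by (elim disjE) linarith+
    thus ?thesis by simp
  qed
  have low: "real m - real i - 1 < u" if "i < m"
  proof -
    have "b < 1 - real m" "c > - real i" "real m \<le> real n" "real i \<ge> 0" using B(1) C(2) that le by auto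
    thus ?thesis using u A12(1,2) A3(2) by (elim disjE) linarith+
  qed
  have sgn: "sgn (pochhammer b n * pochhammer c n) = (-1) ^ (m + i)"
    using sgn_pochhammer[OF b] sgn_pochhammer[OF c] by (simp add: sgn_mult power_add m_def i_def)
  have K: "int (card (pos_zeros (hyp_neg n b c))) = (if even (m + i) then 2 * ((Z + 1) div 2) else 2 * (Z div 2) + 1)"
  proof (cases "i < m")
    case True
    define d where "d = int m - int i"
    have d: "even d = even (m + i)" by (simp add: d_def)
    have "Z = d - 1 \<or> Z = d" unfolding Z_def u_def[symmetric]
      by (rule klein_E_between) (use True low up in \<open>auto simp: d_def\<close>)
    hence "d = (if even d then 2 * ((Z + 1) div 2) else 2 * (Z div 2) + 1)" by presburger
    thus ?thesis using card_pos_zeros_hyp_neg[OF b c] True unfolding d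
      by (simp add: d_def m_def[symmetric] i_def[symmetric] of_nat_diff)
  next
    case False
    have "Z = 0" unfolding Z_def u_def[symmetric] by (rule klein_E_eq_0) (use up False in auto)
    moreover have "card (pos_zeros (hyp_neg n b c)) = (m + i) mod 2"
      using card_pos_zeros_hyp_neg[OF b c] False by (cases "i = m") (auto simp: m_def[symmetric] i_def[symmetric])
    ultimately show ?thesis by (auto simp: mod2_eq_if)
  qed
  have f: "\<lfloor>(real_of_int Z + 1) / 2\<rfloor> = (Z + 1) div 2" "\<lfloor>real_of_int Z / 2\<rfloor> = Z div 2"
    using floor_divide_of_int_eq[of "Z + 1" 2, where ?'a = real] floor_divide_of_int_eq[of Z 2, where ?'a = real] by simp_all
  show "int (card (pos_zeros (hyp_neg n b c))) = 2 * \<lfloor>(real_of_int Z + 1) / 2\<rfloor>" if "pochhammer b n * pochhammer c n > 0"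
  proof -
    have "even (m + i)" using sgn that by (cases "even (m + i)") auto
    thus ?thesis unfolding K f by simp
  qed
  show "int (card (pos_zeros (hyp_neg n b c))) = 2 * \<lfloor>real_of_int Z / 2\<rfloor> + 1" if "pochhammer b n * pochhammer c n < 0"
  proof -
    have "odd (m + i)" using sgn that by (cases "even (m + i)") auto
    thus ?thesis unfolding K f by simp
  qed
qed

theorem theorem3p1:
  fixes n :: nat and b c :: real and X Y Z :: int
  assumes "n > 0"
    and "b \<notin> {- real k | k. k < n}"
    and "c \<notin> {- real k | k. k < n}"
    and "c - b \<notin> {- real k | k. k < n}"
  defines "X \<equiv> klein_E (1/2 * (\<bar>1 - c\<bar> - \<bar>real n + b\<bar> - \<bar>b - c - real n\<bar> + 1))"
    and "Y \<equiv> klein_E (1/2 * (- \<bar>1 - c\<bar> + \<bar>real n + b\<bar> - \<bar>b - c - real n\<bar> + 1))"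
    and "Z \<equiv> klein_E (1/2 * (- \<bar>1 - c\<bar> - \<bar>real n + b\<bar> + \<bar>b - c - real n\<bar> + 1))"
  shows
    "((-1) ^ n * ((- b) gchoose n) * ((b - c) gchoose n) > 0 \<longrightarrow>
        int (num_zeros (hypergeom_poly n b c) {1<..}) = 2 * \<lfloor>(real_of_int X + 1) / 2\<rfloor>) \<and>
     ((-1) ^ n * ((- b) gchoose n) * ((b - c) gchoose n) < 0 \<longrightarrow>
        int (num_zeros (hypergeom_poly n b c) {1<..}) = 2 * \<lfloor>real_of_int X / 2\<rfloor> + 1) \<and>
     (((- c) gchoose n) * ((b - c) gchoose n) > 0 \<longrightarrow>
        int (num_zeros (hypergeom_poly n b c) {0<..<1}) = 2 * \<lfloor>(real_of_int Y + 1) / 2\<rfloor>) \<and>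
     (((- c) gchoose n) * ((b - c) gchoose n) < 0 \<longrightarrow>
        int (num_zeros (hypergeom_poly n b c) {0<..<1}) = 2 * \<lfloor>real_of_int Y / 2\<rfloor> + 1) \<and>
     (((- c) gchoose n) * ((- b) gchoose n) > 0 \<longrightarrow>
        int (num_zeros (hypergeom_poly n b c) {..<0}) = 2 * \<lfloor>(real_of_int Z + 1) / 2\<rfloor>) \<and>
     (((- c) gchoose n) * ((- b) gchoose n) < 0 \<longrightarrow>
        int (num_zeros (hypergeom_poly n b c) {..<0}) = 2 * \<lfloor>real_of_int Z / 2\<rfloor> + 1)"
proof -
  have b: "pochhammer b n \<noteq> 0" and c: "pochhammer c n \<noteq> 0" and cb: "pochhammer (c - b) n \<noteq> 0"
    using assms(2-4) by (auto simp: pochhammer_eq_0_iff)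
  define d where "d = b - real n + 1 - c"
  \<comment> \<open>Primed parameters arise by inversion; \<open>d\<close> and its primed version belong to the expansions about 1.\<close>
  define b' where "b' = 1 - c - real n"
  define c' where "c' = 1 - b - real n"
  define d' where "d' = b' - real n + 1 - c'"
  have flip: "pochhammer (1 - a - real n) n = (-1) ^ n * pochhammer a n" for a :: real
    using pochhammer_minus[of "a + real n - 1" n] by (simp add: algebra_simps)
  have d: "pochhammer d n = (-1) ^ n * pochhammer (c - b) n"
    using flip[of "c - b"] by (simp add: d_def algebra_simps)
  have b': "pochhammer b' n = (-1) ^ n * pochhammer c n" using flip[of c] by (simp add: b'_def)
  have c': "pochhammer c' n = (-1) ^ n * pochhammer b n" using flip[of b] by (simp add: c'_def)
  have d'_eq: "d' = 1 - (c - b) - real n" by (simp add: d'_def b'_def c'_def)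
  have d': "pochhammer d' n = (-1) ^ n * pochhammer (c - b) n" unfolding d'_eq by (rule flip)
  have cb': "c' - b' = c - b" by (simp add: b'_def c'_def)
  have N1: "num_zeros (hypergeom_poly n b c) {1<..} = card (pos_zeros (hyp_neg n b d))"
    using num_zeros_gt_one[OF c cb] d cb by (simp add: d_def)
  have N2: "num_zeros (hypergeom_poly n b c) {0<..<1} = card (pos_zeros (hyp_neg n b' d'))"
    using num_zeros_unit_interval[OF b c] num_zeros_gt_one[of c' n b'] c' d' cb cb' b c
    by (simp add: b'_def[symmetric] c'_def[symmetric] d'_def[symmetric])
  have g: "a gchoose n = (-1) ^ n * pochhammer (- a) n / fact n" for a :: real
    by (rule gbinomial_pochhammer)
  have s: "(-1::real) ^ n * (-1) ^ n = 1" by (simp flip: power_mult_distrib)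
  have S1: "(-1) ^ n * ((- b) gchoose n) * ((b - c) gchoose n) = pochhammer b n * pochhammer d n / (fact n)\<^sup>2"
    unfolding g d using s by (simp add: power2_eq_square)
  have S2: "((- c) gchoose n) * ((b - c) gchoose n) = pochhammer b' n * pochhammer d' n / (fact n)\<^sup>2"
    unfolding g b' d' using s by (simp add: power2_eq_square)
  have S3: "((- c) gchoose n) * ((- b) gchoose n) = pochhammer b n * pochhammer c n / (fact n)\<^sup>2"
    unfolding g using s by (simp add: power2_eq_square)
  have pq: "x / (fact n)\<^sup>2 > 0 \<longleftrightarrow> x > 0" "x / (fact n)\<^sup>2 < 0 \<longleftrightarrow> x < 0" for x :: real
    by (auto simp: zero_less_divide_iff divide_less_0_iff)
  have X: "X = klein_E (1/2 * (- \<bar>1 - d\<bar> - \<bar>real n + b\<bar> + \<bar>b - d - real n\<bar> + 1))"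
  proof -
    have "\<bar>1 - d\<bar> = \<bar>b - c - real n\<bar>" "\<bar>b - d - real n\<bar> = \<bar>1 - c\<bar>" by (auto simp: d_def)
    thus ?thesis by (simp add: X_def algebra_simps)
  qed
  have Y: "Y = klein_E (1/2 * (- \<bar>1 - d'\<bar> - \<bar>real n + b'\<bar> + \<bar>b' - d' - real n\<bar> + 1))"
  proof -
    have "\<bar>1 - d'\<bar> = \<bar>b - c - real n\<bar>" "\<bar>real n + b'\<bar> = \<bar>1 - c\<bar>" "\<bar>b' - d' - real n\<bar> = \<bar>real n + b\<bar>"
      by (auto simp: d'_eq b'_def)
    thus ?thesis by (simp add: Y_def algebra_simps)
  qed
  have nz: "pochhammer d n \<noteq> 0" "pochhammer b' n \<noteq> 0" "pochhammer d' n \<noteq> 0"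
    using b c cb by (auto simp: d b' d')
  show ?thesis
    unfolding S1 S2 S3 pq N1 N2 num_zeros_negative
    using card_pos_zeros_klein[OF b nz(1)] card_pos_zeros_klein[OF nz(2,3)] card_pos_zeros_klein[OF b c]
    unfolding X[symmetric] Y[symmetric] Z_def[symmetric] by blast
qed

end
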